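(* There exist a constant $c>0$ and an integer $d_0$ such that for every integer $d\geq d_0$ there exists a smooth and strictly convex body $K\subset\mathbb{R}^d$ with $$H_{\mathrm{sep}}(K)\geq c\,\bigl(3/\sqrt{8}\bigr)^d.$$
   Context: A convex body in $\mathbb{R}^d$ is a compact convex set with nonempty interior. It is smooth if it has a unique supporting hyperplane at each boundary point, and strictly convex if its boundary contains no nondegenerate line segment. A translative packing of a convex body $K$ is a finite collection $\{x_1+K,\dots,x_n+K\}$ of (distinct) translates of $K$ such that no two of them have interior points in common. Two translates in the packing touch if they have a common boundary point. The packing is totally separable if any two touching translates in it have a separating hyperplane that does not intersect the interior of any translate in the packing. The contact graph of the packing is the graph whose vertices are the translates, two being joined by an edge iff they touch. The separable Hadwiger number $H_{\mathrm{sep}}(K)$ is the maximum degree of a vertex in the contact graph, the maximum being taken over all totally separable packings of translates of $K$. *)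

theory Defs
  imports "HOL-Analysis.Analysis" "HOL-Library.Function_Algebras"
begin

text \<open>
  The dimension is quantified inside the statement, so the d-dimensional space is
  \<^term>\<open>Euclidean_space d\<close>, carried by the functions \<^typ>\<open>nat \<Rightarrow> real\<close> that vanish at all
  indices from d on. Interiors and boundaries are taken relative to this space. The
  pointwise vector space structure below makes the library notions \<^const>\<open>convex\<close> and
  \<^const>\<open>closed_segment\<close> available.
\<close>

instantiation "fun" :: (type, real_vector) real_vector
begin

definition scaleR_fun_def: "r *\<^sub>R f = (\<lambda>i. r *\<^sub>R f i)"

instance
  by standard
    (auto simp: scaleR_fun_def plus_fun_def fun_eq_iff scaleR_add_right scaleR_add_left)

end

abbreviation Rn :: "nat \<Rightarrow> (nat \<Rightarrow> real) set"
  where "Rn d \<equiv> topspace (Euclidean_space d)"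

definition dotp :: "nat \<Rightarrow> (nat \<Rightarrow> real) \<Rightarrow> (nat \<Rightarrow> real) \<Rightarrow> real"
  where "dotp d a x = (\<Sum>i<d. a i * x i)"

definition hyperplane :: "nat \<Rightarrow> (nat \<Rightarrow> real) \<Rightarrow> real \<Rightarrow> (nat \<Rightarrow> real) set"
  where "hyperplane d a b = {x \<in> Rn d. dotp d a x = b}"

definition convex_body :: "nat \<Rightarrow> (nat \<Rightarrow> real) set \<Rightarrow> bool"
  where "convex_body d K \<longleftrightarrow>
    compactin (Euclidean_space d) K \<and> convex K \<and> Euclidean_space d interior_of K \<noteq> {}"

definition supporting_hyperplane ::
    "nat \<Rightarrow> (nat \<Rightarrow> real) set \<Rightarrow> (nat \<Rightarrow> real) \<Rightarrow> (nat \<Rightarrow> real) set \<Rightarrow> bool"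
  where "supporting_hyperplane d K p H \<longleftrightarrow>
    (\<exists>a\<in>Rn d. \<exists>b. a \<noteq> 0 \<and> H = hyperplane d a b \<and> p \<in> H \<and> (\<forall>x\<in>K. dotp d a x \<le> b))"

definition smooth_body :: "nat \<Rightarrow> (nat \<Rightarrow> real) set \<Rightarrow> bool"
  where "smooth_body d K \<longleftrightarrow>
    (\<forall>p \<in> Euclidean_space d frontier_of K. \<exists>!H. supporting_hyperplane d K p H)"

definition strictly_convex :: "nat \<Rightarrow> (nat \<Rightarrow> real) set \<Rightarrow> bool"
  where "strictly_convex d K \<longleftrightarrow>
    (\<nexists>x y. x \<noteq> y \<and> closed_segment x y \<subseteq> Euclidean_space d frontier_of K)"

text \<open>A packing is the finite set of its members, so these are automatically distinct.\<close>

definition translative_packing ::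
    "nat \<Rightarrow> (nat \<Rightarrow> real) set \<Rightarrow> (nat \<Rightarrow> real) set set \<Rightarrow> bool"
  where "translative_packing d K P \<longleftrightarrow>
    finite P \<and> (\<forall>C\<in>P. \<exists>x\<in>Rn d. C = (+) x ` K) \<and>
    (\<forall>C\<in>P. \<forall>D\<in>P. C \<noteq> D \<longrightarrow>
      Euclidean_space d interior_of C \<inter> Euclidean_space d interior_of D = {})"

definition touch :: "nat \<Rightarrow> (nat \<Rightarrow> real) set \<Rightarrow> (nat \<Rightarrow> real) set \<Rightarrow> bool"
  where "touch d C D \<longleftrightarrow>
    Euclidean_space d frontier_of C \<inter> Euclidean_space d frontier_of D \<noteq> {}"

definition separating_hyperplane ::
    "nat \<Rightarrow> (nat \<Rightarrow> real) set \<Rightarrow> (nat \<Rightarrow> real) set \<Rightarrow> (nat \<Rightarrow> real) set \<Rightarrow> bool"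
  where "separating_hyperplane d C D H \<longleftrightarrow>
    (\<exists>a\<in>Rn d. \<exists>b. a \<noteq> 0 \<and> H = hyperplane d a b \<and>
      (\<forall>x\<in>C. dotp d a x \<le> b) \<and> (\<forall>x\<in>D. b \<le> dotp d a x))"

definition totally_separable ::
    "nat \<Rightarrow> (nat \<Rightarrow> real) set \<Rightarrow> (nat \<Rightarrow> real) set set \<Rightarrow> bool"
  where "totally_separable d K P \<longleftrightarrow>
    translative_packing d K P \<and>
    (\<forall>C\<in>P. \<forall>D\<in>P. C \<noteq> D \<and> touch d C D \<longrightarrow>
      (\<exists>H. separating_hyperplane d C D H \<and>
        (\<forall>E\<in>P. H \<inter> Euclidean_space d interior_of E = {})))"

definition contact_edges ::
    "nat \<Rightarrow> (nat \<Rightarrow> real) set set \<Rightarrow> (nat \<Rightarrow> real) set set set"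
  where "contact_edges d P = {{C, D} | C D. C \<in> P \<and> D \<in> P \<and> C \<noteq> D \<and> touch d C D}"

definition contact_degree ::
    "nat \<Rightarrow> (nat \<Rightarrow> real) set set \<Rightarrow> (nat \<Rightarrow> real) set \<Rightarrow> nat"
  where "contact_degree d P C = card {e \<in> contact_edges d P. C \<in> e}"

text \<open>
  For a convex body the degrees are bounded (by the ordinary Hadwiger number), so the
  maximum is taken over a finite nonempty set; for other arguments the value is irrelevant.
\<close>

definition H_sep :: "nat \<Rightarrow> (nat \<Rightarrow> real) set \<Rightarrow> nat"
  where "H_sep d K = Max {contact_degree d P C | P C. totally_separable d K P \<and> C \<in> P}"

end

theory Submission
  imports Defs
begin

text \<open>
  Let \<open>K\<close> be a centrally symmetric smooth convex body and let \<open>u\<close> range over finitely many of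
  its boundary points, with supporting functionals \<open>a u\<close>. The translates \<open>2 u + K\<close>
  touch \<open>K\<close>, and together with \<open>K\<close> they form a totally separable packing as soon as every
  \<open>a u\<close> is nonpositive at all the other points (\<open>H_sep_ge_card\<close>). So one looks for many pairs of
  a functional \<open>f p\<close> and a point \<open>u p\<close> that form an obtuse system, meaning that the value of
  \<open>f p\<close> is 1 at \<open>u p\<close> and lies strictly between -1 and 0 at every other \<open>u q\<close>. Strictness leaves
  room to round off the polytope cut out by these functionals to a smooth and strictly convex
  body, at which the functionals change only slightly (\<open>body_from_obtuse_system\<close>).

  The matrix of an obtuse system need not be positive semidefinite, and this is why its size can
  be exponential in the dimension. If unit vectors have pairwise inner products
  strictly between -1/3 and 1/3, then the affine function that takes 1/3 to 0 and 1 to 1 takes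
  -1/3 to -1, so applying it to their Gram matrix, at the cost of one more dimension, gives an
  obtuse system (\<open>body_with_large_separable_Hadwiger_number\<close>).

  The spherical cap of directions whose inner product with a fixed unit vector is at least 1/3
  has angular radius of sine \<open>sqrt 8 / 3\<close>, and its cone within the unit ball fits into a ball of
  that radius. Hence the excluded caps around \<open>n\<close> vectors and their antipodes cannot cover the
  sphere while \<open>n\<close> is below half of \<open>(3 / sqrt 8) ^ m\<close>, and a greedy choice yields that many vectors
  (\<open>spherical_code_exists\<close>). The lost dimension only affects the constant.
\<close>

section \<open>Linear algebra and topology of the coordinate space\<close>

lemma dotp_add_right: "dotp d a (x + y) = dotp d a x + dotp d a y"
  and dotp_add_left: "dotp d (x + y) a = dotp d x a + dotp d y a"
  and dotp_diff_right: "dotp d a (x - y) = dotp d a x - dotp d a y"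
  and dotp_diff_left: "dotp d (x - y) a = dotp d x a - dotp d y a"
  and dotp_scaleR_right: "dotp d a (r *\<^sub>R x) = r * dotp d a x"
  and dotp_scaleR_left: "dotp d (r *\<^sub>R x) a = r * dotp d x a"
  and dotp_minus_right: "dotp d a (- x) = - dotp d a x"
  and dotp_minus_left: "dotp d (- x) a = - dotp d x a"
  and dotp_zero_right: "dotp d a 0 = 0"
  and dotp_zero_left: "dotp d 0 a = 0"
  by (simp_all add: dotp_def scaleR_fun_def algebra_simps sum.distrib sum_subtractf sum_distrib_left sum_negf)

lemmas dotp_linear = dotp_add_right dotp_add_left dotp_diff_right dotp_diff_left dotp_scaleR_right
  dotp_scaleR_left dotp_minus_right dotp_minus_left dotp_zero_right dotp_zero_left

lemma dotp_commute: "dotp d x y = dotp d y x"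
  by (simp add: dotp_def mult.commute)

lemma dotp_self_nonneg: "dotp d x x \<ge> 0"
  by (simp add: dotp_def sum_nonneg)

lemma dotp_self_pos: "x \<in> Rn d \<Longrightarrow> x \<noteq> 0 \<Longrightarrow> dotp d x x > 0"
proof -
  assume "x \<in> Rn d" "x \<noteq> 0"
  then obtain k where "x k \<noteq> 0" by (auto simp: fun_eq_iff)
  with \<open>x \<in> Rn d\<close> have "k < d" by (auto simp: topspace_Euclidean_space not_le[symmetric])
  then show ?thesis
    unfolding dotp_def using \<open>x k \<noteq> 0\<close>
    by (intro sum_pos2[of _ k]) (auto simp: zero_less_mult_iff linorder_neq_iff)
qed

lemma Rn_closed:
  "0 \<in> Rn d" "x \<in> Rn d \<Longrightarrow> y \<in> Rn d \<Longrightarrow> x + y \<in> Rn d" "x \<in> Rn d \<Longrightarrow> y \<in> Rn d \<Longrightarrow> x - y \<in> Rn d"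
  "x \<in> Rn d \<Longrightarrow> - x \<in> Rn d" "x \<in> Rn d \<Longrightarrow> r *\<^sub>R x \<in> Rn d"
  by (auto simp: topspace_Euclidean_space scaleR_fun_def)

text \<open>
  An interior point can be moved a little in the direction of the normal \<^term>\<open>a\<close> without leaving
  the set. The topological facts about halfspaces and separation below all rest on this.
\<close>

lemma interior_halfspace_strict:
  assumes x: "x \<in> Euclidean_space d interior_of E"
    and E: "\<And>y. y \<in> E \<Longrightarrow> dotp d a y \<le> b"
    and a: "a \<in> Rn d" "a \<noteq> 0"
  shows "dotp d a x < b"
proof -
  obtain T where T: "openin (Euclidean_space d) T" "x \<in> T" "T \<subseteq> E"
    using x by (auto simp: interior_of_def)
  let ?line = "\<lambda>t i. if i < d then x i + t * a i else 0"
  have "continuous_map euclideanreal (Euclidean_space d) ?line"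
    unfolding continuous_map_componentwise_Euclidean_space
    by (auto intro!: continuous_intros)
  then have "open {t. ?line t \<in> T}"
    using openin_continuous_map_preimage[OF _ T(1)] by fastforce
  moreover have line: "?line t = x + t *\<^sub>R a" for t
    using a(1) T(1,2) openin_subset
    by (fastforce simp: topspace_Euclidean_space fun_eq_iff scaleR_fun_def)
  ultimately have "open {t. x + t *\<^sub>R a \<in> T}" by simp
  moreover have "0 \<in> {t. x + t *\<^sub>R a \<in> T}" using T(2) by simp
  ultimately obtain e where e: "e > 0" "cball 0 e \<subseteq> {t. x + t *\<^sub>R a \<in> T}"
    by (meson open_contains_cball)
  have "x + e *\<^sub>R a \<in> T" using subsetD[OF e(2), of e] e(1) by simp
  then have "dotp d a (x + e *\<^sub>R a) \<le> b" using T(3) E by auto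
  then have "dotp d a x + e * dotp d a a \<le> b" by (simp add: dotp_linear)
  moreover have "e * dotp d a a > 0" using dotp_self_pos[OF a] e(1) by simp
  ultimately show ?thesis by linarith
qed

lemma separating_hyperplane_disjoint_interiors:
  assumes "separating_hyperplane d C D H"
  shows "Euclidean_space d interior_of C \<inter> Euclidean_space d interior_of D = {}"
proof -
  obtain a b where a: "a \<in> Rn d" "a \<noteq> 0" "\<And>x. x \<in> C \<Longrightarrow> dotp d a x \<le> b"
    "\<And>x. x \<in> D \<Longrightarrow> b \<le> dotp d a x"
    using assms by (auto simp: separating_hyperplane_def)
  have "dotp d a x < b" if "x \<in> Euclidean_space d interior_of C" for x
    using interior_halfspace_strict[OF that a(3,1,2)] .
  moreover have "dotp d (-a) x < -b" if "x \<in> Euclidean_space d interior_of D" for x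
    by (rule interior_halfspace_strict[OF that]) (use a in \<open>auto simp: dotp_linear Rn_closed\<close>)
  ultimately show ?thesis by (force simp: dotp_linear)
qed

lemma separating_hyperplane_commute:
  "separating_hyperplane d C D H \<longleftrightarrow> separating_hyperplane d D C H"
proof -
  have "separating_hyperplane d D C H" if sep: "separating_hyperplane d C D H" for C D
  proof -
    obtain a b where a: "a \<in> Rn d" "a \<noteq> 0" "H = hyperplane d a b"
      "\<And>x. x \<in> C \<Longrightarrow> dotp d a x \<le> b" "\<And>x. x \<in> D \<Longrightarrow> b \<le> dotp d a x"
      using sep unfolding separating_hyperplane_def by blast
    have "hyperplane d a b = hyperplane d (- a) (- b)"
      by (auto simp: hyperplane_def dotp_linear)
    then show ?thesis unfolding separating_hyperplane_def
      using a by (intro bexI[of _ "- a"] exI[of _ "- b"]) (auto simp: dotp_linear Rn_closed)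
  qed
  then show ?thesis by blast
qed

lemma frontier_ofI_halfspace:
  assumes "x \<in> E" "E \<subseteq> Rn d" "\<And>y. y \<in> E \<Longrightarrow> dotp d a y \<le> dotp d a x" "a \<in> Rn d" "a \<noteq> 0"
  shows "x \<in> Euclidean_space d frontier_of E"
proof -
  have "x \<notin> Euclidean_space d interior_of E"
    using interior_halfspace_strict[of x d E a "dotp d a x"] assms by auto
  moreover have "x \<in> Euclidean_space d closure_of E"
    using closure_of_subset[OF assms(2)] assms(1) by auto
  ultimately show ?thesis by (simp add: frontier_of_def)
qed

lemma interior_of_translation:
  assumes "v \<in> Rn d"
  shows "Euclidean_space d interior_of ((+) v ` K) = (+) v ` (Euclidean_space d interior_of K)"
proof -
  have sub: "(+) v ` (Euclidean_space d interior_of K) \<subseteq> Euclidean_space d interior_of ((+) v ` K)"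
    if v: "v \<in> Rn d" for v K
  proof (rule interior_of_maximal)
    show "(+) v ` (Euclidean_space d interior_of K) \<subseteq> (+) v ` K"
      by (intro image_mono interior_of_subset)
    let ?T = "Euclidean_space d interior_of K"
    have "continuous_map (Euclidean_space d) (Euclidean_space d) (\<lambda>x i. x i - v i)"
      by (rule continuous_map_Euclidean_space_diff) (use v in auto)
    from openin_continuous_map_preimage[OF this openin_interior_of, of K]
    have "openin (Euclidean_space d) {x \<in> Rn d. (\<lambda>i. x i - v i) \<in> ?T}" .
    moreover have "{x \<in> Rn d. (\<lambda>i. x i - v i) \<in> ?T} = (+) v ` ?T"
    proof -
      have eq: "(\<lambda>i. x i - v i) = x - v" for x by (simp add: fun_eq_iff)
      have "x \<in> Rn d \<and> x - v \<in> ?T \<longleftrightarrow> x \<in> (+) v ` ?T" for x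
      proof
        assume "x \<in> Rn d \<and> x - v \<in> ?T"
        moreover have "x = v + (x - v)" by simp
        ultimately show "x \<in> (+) v ` ?T" by blast
      next
        assume "x \<in> (+) v ` ?T"
        then obtain y where y: "y \<in> ?T" "x = v + y" by blast
        then have "x \<in> Rn d" using Rn_closed(2)[OF v subsetD[OF interior_of_subset_topspace y(1)]] by simp
        moreover have "x - v = y" using y(2) by (simp add: fun_eq_iff)
        ultimately show "x \<in> Rn d \<and> x - v \<in> ?T" using y(1) by simp
      qed
      then show ?thesis unfolding eq by blast
    qed
    ultimately show "openin (Euclidean_space d) ((+) v ` ?T)" by simp
  qed
  have "(+) (-v) ` (Euclidean_space d interior_of ((+) v ` K))
      \<subseteq> Euclidean_space d interior_of ((+) (-v) ` (+) v ` K)"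
    using sub[OF Rn_closed(4)[OF assms]] .
  also have "(+) (-v) ` (+) v ` K = K" by (force simp: image_image)
  finally have "(+) v ` (+) (-v) ` (Euclidean_space d interior_of ((+) v ` K))
      \<subseteq> (+) v ` (Euclidean_space d interior_of K)" by (rule image_mono)
  moreover have "(+) v ` (+) (-v) ` X = X" for X :: "(nat \<Rightarrow> real) set" by (force simp: image_image)
  ultimately have "Euclidean_space d interior_of ((+) v ` K) \<subseteq> (+) v ` (Euclidean_space d interior_of K)"
    by (simp only:)
  then show ?thesis using sub[OF assms, of K] by (rule subset_antisym)
qed

text \<open>
  An open set of the product topology restricts only finitely many coordinates; in
  \<^term>\<open>Euclidean_space d\<close> the coordinates from \<^term>\<open>d\<close> on are all zero anyway, so a single box width
  for the first \<^term>\<open>d\<close> coordinates suffices.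
\<close>

lemma interior_of_contains_box:
  assumes z: "z \<in> Euclidean_space d interior_of K"
  obtains \<eta> where "\<eta> > 0" "\<And>y. y \<in> Rn d \<Longrightarrow> (\<And>i. i < d \<Longrightarrow> \<bar>y i - z i\<bar> < \<eta>) \<Longrightarrow>
    y \<in> Euclidean_space d interior_of K"
proof -
  have "openin (Euclidean_space d) (Euclidean_space d interior_of K)" by simp
  then obtain T where T: "openin (powertop_real UNIV) T"
      "Euclidean_space d interior_of K = T \<inter> {x. \<forall>i\<ge>d. x i = 0}"
    unfolding Euclidean_space_def openin_subtopology by blast
  have "z \<in> T" using z T(2) by auto
  with T(1) obtain U where U: "\<And>i. openin euclideanreal (U i)" "z \<in> Pi\<^sub>E UNIV U" "Pi\<^sub>E UNIV U \<subseteq> T"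
    unfolding openin_product_topology_alt by (meson UNIV_I)
  have "\<forall>i. \<exists>e>0. \<forall>t. \<bar>t - z i\<bar> < e \<longrightarrow> t \<in> U i"
  proof
    fix i
    have "open (U i)" "z i \<in> U i" using U(1,2) by (auto simp: PiE_def Pi_def)
    then show "\<exists>e>0. \<forall>t. \<bar>t - z i\<bar> < e \<longrightarrow> t \<in> U i"
      unfolding open_dist by (auto simp: dist_real_def)
  qed
  then obtain e where e: "\<And>i. e i > 0" "\<And>i t. \<bar>t - z i\<bar> < e i \<Longrightarrow> t \<in> U i" by metis
  have zz: "z \<in> Rn d" using subsetD[OF interior_of_subset_topspace z] .
  define \<eta> where "\<eta> = Min (insert 1 (e ` {..<d}))"
  show ?thesis
  proof
    show "\<eta> > 0" using e(1) by (auto simp: \<eta>_def)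
    fix y assume y: "y \<in> Rn d" "\<And>i. i < d \<Longrightarrow> \<bar>y i - z i\<bar> < \<eta>"
    have "y i \<in> U i" for i
    proof (cases "i < d")
      case True
      then have "\<eta> \<le> e i" by (auto simp: \<eta>_def)
      then show ?thesis using e(2) y(2)[OF True] by (meson less_le_trans)
    next
      case False
      then have "y i = z i" using y(1) zz by (auto simp: topspace_Euclidean_space)
      then show ?thesis using U(2) by (auto simp: PiE_def Pi_def)
    qed
    then have "y \<in> T" using U(3) by auto
    then show "y \<in> Euclidean_space d interior_of K"
      using T(2) y(1) by (auto simp: topspace_Euclidean_space)
  qed
qed

lemma convex_body_bounded:
  assumes "convex_body d K"
  obtains R where "\<And>x i. x \<in> K \<Longrightarrow> \<bar>x i\<bar> \<le> R i"
proof -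
  have "compactin (Euclidean_space d) K" using assms by (simp add: convex_body_def)
  then have "compactin (powertop_real UNIV) K"
    unfolding Euclidean_space_def compactin_subtopology by blast
  then have "compact ((\<lambda>x. x i) ` K)" for i
    using image_compactin[of "powertop_real UNIV" K euclideanreal "\<lambda>x. x i"]
      continuous_map_product_projection[of i UNIV "\<lambda>_. euclideanreal"] by simp
  then have "\<exists>r. \<forall>x\<in>K. \<bar>x i\<bar> \<le> r" for i
    using compact_imp_bounded[of "(\<lambda>x. x i) ` K"] by (auto simp: bounded_iff)
  then obtain R where "\<And>i. \<forall>x\<in>K. \<bar>x i\<bar> \<le> R i" by metis
  then show ?thesis using that by blast
qed

section \<open>Contact degrees and the separable Hadwiger number\<close>

lemma contact_degree_le_card_touching:
  assumes "finite P"
  shows "contact_degree d P C \<le> card {D \<in> P. touch d C D}"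
proof -
  have sym: "touch d D C \<longleftrightarrow> touch d C D" for D by (auto simp: touch_def Int_commute)
  have "{e \<in> contact_edges d P. C \<in> e} \<subseteq> (\<lambda>D. {C, D}) ` {D \<in> P. touch d C D}"
    unfolding contact_edges_def using sym by (auto simp: doubleton_eq_iff)
  then have "card {e \<in> contact_edges d P. C \<in> e} \<le> card ((\<lambda>D. {C, D}) ` {D \<in> P. touch d C D})"
    using assms by (intro card_mono) auto
  also have "\<dots> \<le> card {D \<in> P. touch d C D}" using assms by (intro card_image_le) auto
  finally show ?thesis by (simp add: contact_degree_def)
qed

text \<open>
  The number \<^term>\<open>H_sep d K\<close> is a \<^const>\<open>Max\<close> over a set of degrees, which carries information only if
  that set is finite. A bound that is uniform in the packing comes from a pigeonhole argument:
  translation vectors of the neighbours of one member lie in a fixed bounded region, and two of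
  them in the same cell of a sufficiently fine grid would force the interiors to meet.
\<close>

lemma finite_contact_degrees:
  assumes "convex_body d K"
  shows "finite {contact_degree d P C | P C. totally_separable d K P \<and> C \<in> P}"
proof -
  obtain z where z: "z \<in> Euclidean_space d interior_of K"
    using assms by (auto simp: convex_body_def)
  obtain \<eta> where \<eta>: "\<eta> > 0" "\<And>y. y \<in> Rn d \<Longrightarrow> (\<And>i. i < d \<Longrightarrow> \<bar>y i - z i\<bar> < \<eta>) \<Longrightarrow>
    y \<in> Euclidean_space d interior_of K"
    using interior_of_contains_box[OF z] by blast
  obtain R where R: "\<And>x i. x \<in> K \<Longrightarrow> \<bar>x i\<bar> \<le> R i" using convex_body_bounded[OF assms] by blast
  define cells where "cells = (\<Pi>\<^sub>E i\<in>{..<d}. {\<lfloor>-(2 * R i / \<eta>)\<rfloor>..\<lfloor>2 * R i / \<eta>\<rfloor>})"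
  have "finite cells" by (auto simp: cells_def intro!: finite_PiE)
  have comp: "compactin (Euclidean_space d) K" using assms by (simp add: convex_body_def)
  have "contact_degree d P C \<le> card cells" if P: "totally_separable d K P" "C \<in> P" for P C
  proof -
    have pack: "translative_packing d K P" using P by (simp add: totally_separable_def)
    then have "finite P" by (simp add: translative_packing_def)
    have "\<exists>x. \<forall>D\<in>P. x D \<in> Rn d \<and> D = (+) (x D) ` K"
      using pack unfolding translative_packing_def by metis
    then obtain x where "\<forall>D\<in>P. x D \<in> Rn d \<and> D = (+) (x D) ` K" ..
    then have x: "\<And>D. D \<in> P \<Longrightarrow> x D \<in> Rn d" "\<And>D. D \<in> P \<Longrightarrow> (+) (x D) ` K = D"
      by simp_all
    have frontier: "Euclidean_space d frontier_of D \<subseteq> D" if "D \<in> P" for D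
    proof -
      have "continuous_map (Euclidean_space d) (Euclidean_space d) (\<lambda>y i. x D i + y i)"
        by (rule continuous_map_Euclidean_space_add) (use x(1)[OF that] in auto)
      then have "compactin (Euclidean_space d) D"
        using image_compactin[OF comp, of "Euclidean_space d" "\<lambda>y i. x D i + y i"] x(2)[OF that]
        by (simp add: plus_fun_def)
      then show ?thesis
        by (intro frontier_of_subset_closedin compactin_imp_closedin Hausdorff_Euclidean_space)
    qed
    define cell where "cell D = (\<lambda>i\<in>{..<d}. \<lfloor>(x D i - x C i) / \<eta>\<rfloor>)" for D
    have "inj_on cell {D \<in> P. touch d C D}"
    proof (rule inj_onI)
      fix D E assume D: "D \<in> {D \<in> P. touch d C D}" and E: "E \<in> {D \<in> P. touch d C D}"
        and eq: "cell D = cell E"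
      show "D = E"
      proof (rule ccontr)
        assume "D \<noteq> E"
        then have disj: "Euclidean_space d interior_of D \<inter> Euclidean_space d interior_of E = {}"
          using pack D E by (simp add: translative_packing_def)
        have close: "\<bar>x D i - x E i\<bar> < \<eta>" if "i < d" for i
        proof -
          have "\<lfloor>(x D i - x C i) / \<eta>\<rfloor> = \<lfloor>(x E i - x C i) / \<eta>\<rfloor>"
            using fun_cong[OF eq, of i] that by (simp add: cell_def)
          then have "\<bar>(x D i - x C i) / \<eta> - (x E i - x C i) / \<eta>\<bar> < 1" by linarith
          then have "\<bar>(x D i - x E i) / \<eta>\<bar> < 1" by (simp add: diff_divide_distrib)
          then show ?thesis using \<eta>(1) by (simp add: abs_divide)
        qed
        \<comment> \<open>The translate of \<^term>\<open>z\<close> by \<^term>\<open>x D\<close> is interior to both \<^term>\<open>D\<close> and \<^term>\<open>E\<close>.\<close>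
        have "z + x D - x E \<in> Euclidean_space d interior_of K"
          using close z x(1) D E subsetD[OF interior_of_subset_topspace z]
          by (intro \<eta>(2)) (auto intro!: Rn_closed)
        then have "x E + (z + x D - x E) \<in> (+) (x E) ` (Euclidean_space d interior_of K)"
          by (rule imageI)
        then have "x E + (z + x D - x E) \<in> Euclidean_space d interior_of E"
          using interior_of_translation[OF x(1), of E K] x(2)[of E] E by simp
        moreover have "x D + z \<in> Euclidean_space d interior_of D"
          using interior_of_translation[OF x(1), of D K] x(2)[of D] D z by auto
        moreover have "x E + (z + x D - x E) = x D + z" by simp
        ultimately show False using disj by auto
      qed
    qed
    moreover have "cell ` {D \<in> P. touch d C D} \<subseteq> cells"
    proof clarify
      fix D assume D: "D \<in> P" "touch d C D"
      then obtain y where "y \<in> C" "y \<in> D"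
        using frontier[OF D(1)] frontier[OF P(2)] by (auto simp: touch_def)
      then obtain k k' where k: "k \<in> K" "k' \<in> K" "y = x C + k" "y = x D + k'"
        using x(2)[OF D(1)] x(2)[OF P(2)] by blast
      have "\<bar>x D i - x C i\<bar> \<le> 2 * R i" for i
        using R[OF k(1), of i] R[OF k(2), of i] fun_cong[OF k(3), of i] fun_cong[OF k(4), of i] by auto
      then have *: "\<bar>(x D i - x C i) / \<eta>\<bar> \<le> 2 * R i / \<eta>" for i
        using \<eta>(1) by (simp add: abs_divide divide_right_mono)
      have "- (2 * R i / \<eta>) \<le> (x D i - x C i) / \<eta>" "(x D i - x C i) / \<eta> \<le> 2 * R i / \<eta>" for i
        using *[of i] by linarith+
      then show "cell D \<in> cells" unfolding cells_def cell_def
        by (auto intro!: floor_mono)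
    qed
    ultimately have "card {D \<in> P. touch d C D} \<le> card cells"
      using \<open>finite cells\<close> by (meson card_inj_on_le)
    then show ?thesis using contact_degree_le_card_touching[OF \<open>finite P\<close>] le_trans by blast
  qed
  then have "{contact_degree d P C | P C. totally_separable d K P \<and> C \<in> P} \<subseteq> {..card cells}"
    by auto
  then show ?thesis by (rule finite_subset) auto
qed

text \<open>
  The packing consists of \<^term>\<open>K\<close> and its translates by \<^term>\<open>2 *\<^sub>R u\<close>, each touching the
  centrally symmetric body \<^term>\<open>K\<close> at \<^term>\<open>u\<close>. The hyperplane supporting \<^term>\<open>K\<close> at \<^term>\<open>u\<close>
  separates these two. It misses the interior of the translate belonging to another \<^term>\<open>w\<close>
  because \<^term>\<open>a u\<close> is nonpositive at \<^term>\<open>w\<close>: this translate then stays on the side of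
  \<^term>\<open>K\<close>. The same hyperplane thus also separates the translate at \<^term>\<open>u\<close> from all the other
  outer ones, so no two of them overlap.
\<close>

lemma H_sep_ge_card:
  assumes body: "convex_body d K" and sym: "\<And>x. x \<in> K \<Longrightarrow> - x \<in> K"
    and "finite U" "U \<subseteq> K"
    and a: "\<And>u. u \<in> U \<Longrightarrow> a u \<in> Rn d"
    and pos: "\<And>u. u \<in> U \<Longrightarrow> dotp d (a u) u > 0"
    and supp: "\<And>u x. u \<in> U \<Longrightarrow> x \<in> K \<Longrightarrow> dotp d (a u) x \<le> dotp d (a u) u"
    and obtuse: "\<And>u w. u \<in> U \<Longrightarrow> w \<in> U \<Longrightarrow> u \<noteq> w \<Longrightarrow> dotp d (a u) w \<le> 0"
  shows "H_sep d K \<ge> card U"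
proof -
  have K: "K \<subseteq> Rn d" using body by (auto simp: convex_body_def dest: compactin_subset_topspace)
  define N where "N u = (+) (2 *\<^sub>R u) ` K" for u
  define P where "P = insert K (N ` U)"
  define H where "H u = hyperplane d (a u) (dotp d (a u) u)" for u
  have a0: "a u \<noteq> 0" if "u \<in> U" for u using pos[OF that] by (auto simp: dotp_linear)
  have above: "dotp d (a u) u \<le> dotp d (a u) x" if "u \<in> U" "x \<in> N u" for u x
    using that supp[OF that(1) sym] by (auto simp: N_def dotp_linear)
      (smt (verit, best) dotp_minus_right)
  have below: "dotp d (a u) x \<le> dotp d (a u) u" if u: "u \<in> U" and D: "D \<in> P" "D \<noteq> N u" "x \<in> D" for u D x
  proof (cases "D = K")
    case True then show ?thesis using D(3) supp[OF u] by simp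
  next
    case False
    then obtain w where w: "w \<in> U" "D = N w" using D(1) by (auto simp: P_def)
    then have "u \<noteq> w" using D(2) by auto
    then have "dotp d (a u) w \<le> 0" using obtuse u w(1) by blast
    then show ?thesis using D(3) supp[OF u] w(2) by (fastforce simp: N_def dotp_linear)
  qed
  \<comment> \<open>The antipode of the contact point in its translate lies strictly beyond the separating
    hyperplane, which tells the translate apart from all other members.\<close>
  have far: "3 *\<^sub>R u \<in> N u" if "u \<in> U" for u
    using that \<open>U \<subseteq> K\<close> by (auto simp: N_def scaleR_fun_def fun_eq_iff intro!: image_eqI[of _ _ u])
  have N_ne: "N u \<noteq> D" if u: "u \<in> U" and "\<forall>x\<in>D. dotp d (a u) x \<le> dotp d (a u) u" for u D
    using far[OF u] that pos[OF u] by (force simp: dotp_linear)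
  have N_ne_K: "N u \<noteq> K" if "u \<in> U" for u using N_ne[OF that] supp[OF that] by blast
  have N_inj: "u = w" if "u \<in> U" "w \<in> U" "N u = N w" for u w
  proof (rule ccontr)
    assume "u \<noteq> w"
    then have "dotp d (a u) w \<le> 0" using obtuse that by blast
    then have "\<forall>x\<in>N w. dotp d (a u) x \<le> dotp d (a u) u"
      using supp[OF that(1)] by (fastforce simp: N_def dotp_linear)
    then show False using N_ne[OF that(1)] that(3) by blast
  qed
  have sep: "separating_hyperplane d D (N u) (H u)" if "u \<in> U" "D \<in> P" "D \<noteq> N u" for u D
    unfolding separating_hyperplane_def H_def
    using that a a0 above below by (intro bexI[of _ "a u"] exI[of _ "dotp d (a u) u"]) auto
  have miss: "H u \<inter> Euclidean_space d interior_of E = {}" if u: "u \<in> U" and E: "E \<in> P" for u E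
  proof (cases "E = N u")
    case True
    have "dotp d (- a u) x < - dotp d (a u) u" if "x \<in> Euclidean_space d interior_of E" for x
      by (rule interior_halfspace_strict[OF that])
        (use above[OF u] a[OF u] a0[OF u] True in \<open>auto simp: dotp_linear Rn_closed\<close>)
    then show ?thesis by (force simp: H_def hyperplane_def dotp_linear)
  next
    case False
    have "dotp d (a u) x < dotp d (a u) u" if "x \<in> Euclidean_space d interior_of E" for x
      by (rule interior_halfspace_strict[OF that below[OF u E False] a[OF u] a0[OF u]])
    then show ?thesis by (force simp: H_def hyperplane_def)
  qed
  have sep': "\<exists>H. separating_hyperplane d C D H \<and> (\<forall>E\<in>P. H \<inter> Euclidean_space d interior_of E = {})"
    if CD: "C \<in> P" "D \<in> P" "C \<noteq> D" for C D
  proof (cases "D = K")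
    case True
    then obtain u where u: "u \<in> U" "C = N u" using CD by (auto simp: P_def)
    then have "separating_hyperplane d C D (H u)"
      using sep[OF u(1) CD(2)] CD(3) separating_hyperplane_commute by simp
    then show ?thesis using miss[OF u(1)] by blast
  next
    case False
    then obtain u where u: "u \<in> U" "D = N u" using CD by (auto simp: P_def)
    then have "separating_hyperplane d C D (H u)" using sep[OF u(1) CD(1)] CD(3) by simp
    then show ?thesis using miss[OF u(1)] by blast
  qed
  have "translative_packing d K P" unfolding translative_packing_def
  proof (intro conjI ballI impI)
    show "finite P" using \<open>finite U\<close> by (simp add: P_def)
    show "\<exists>x\<in>Rn d. C = (+) x ` K" if "C \<in> P" for C
    proof (cases "C = K")
      case True then show ?thesis using Rn_closed(1) by (intro bexI[of _ 0]) auto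
    next
      case False
      then show ?thesis using that K \<open>U \<subseteq> K\<close> by (auto simp: P_def N_def intro!: Rn_closed)
    qed
    show "Euclidean_space d interior_of C \<inter> Euclidean_space d interior_of D = {}"
      if "C \<in> P" "D \<in> P" "C \<noteq> D" for C D
      using sep'[OF that] separating_hyperplane_disjoint_interiors by blast
  qed
  then have tot: "totally_separable d K P" using sep' by (auto simp: totally_separable_def)
  have touch: "touch d K (N u)" if u: "u \<in> U" for u
  proof -
    have "u \<in> Euclidean_space d frontier_of K"
      using u \<open>U \<subseteq> K\<close> K supp a a0 by (intro frontier_ofI_halfspace[of _ _ _ "a u"]) auto
    moreover have "u \<in> Euclidean_space d frontier_of (N u)"
    proof (rule frontier_ofI_halfspace[of _ _ _ "- a u"])
      show "u \<in> N u" using u sym \<open>U \<subseteq> K\<close>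
        by (auto simp: N_def scaleR_fun_def fun_eq_iff intro!: image_eqI[of _ _ "-u"])
      show "N u \<subseteq> Rn d" using K u \<open>U \<subseteq> K\<close> by (auto simp: N_def intro!: Rn_closed)
    qed (use above[OF u] a[OF u] a0[OF u] in \<open>auto simp: dotp_linear Rn_closed\<close>)
    ultimately show ?thesis by (auto simp: touch_def)
  qed
  have "card U = card ((\<lambda>u. {K, N u}) ` U)"
    using N_inj by (intro card_image[symmetric] inj_onI) (auto simp: doubleton_eq_iff)
  also have "\<dots> \<le> contact_degree d P K"
    unfolding contact_degree_def
  proof (rule card_mono)
    have "contact_edges d P \<subseteq> Pow P" by (auto simp: contact_edges_def)
    then show "finite {e \<in> contact_edges d P. K \<in> e}"
      using \<open>finite U\<close> by (auto simp: P_def intro: finite_subset)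
    show "(\<lambda>u. {K, N u}) ` U \<subseteq> {e \<in> contact_edges d P. K \<in> e}"
    proof clarify
      fix u assume u: "u \<in> U"
      have "K \<in> P" "N u \<in> P" using u by (auto simp: P_def)
      then show "{K, N u} \<in> contact_edges d P \<and> K \<in> {K, N u}"
        using touch[OF u] N_ne_K[OF u] unfolding contact_edges_def by blast
    qed
  qed
  also have "\<dots> \<le> H_sep d K" unfolding H_sep_def
    using tot by (intro Max_ge finite_contact_degrees body) (auto simp: P_def)
  finally show ?thesis .
qed

section \<open>Sublevel sets of functions pinched between paraboloids\<close>

text \<open>
  For each point \<^term>\<open>x\<close> the function \<^term>\<open>G\<close> lies between two paraboloids that agree with it at
  \<^term>\<open>x\<close> and have the gradient \<^term>\<open>g x\<close> there. The lower one makes sublevel sets compact and strictly convex, the upper one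
  makes them smooth, with outer normal \<^term>\<open>g p\<close> at the boundary point \<^term>\<open>p\<close>. Both inequalities
  are inherited by sums, which makes such functions easy to build.
\<close>

locale pinched_even_function =
  fixes d :: nat and G :: "(nat \<Rightarrow> real) \<Rightarrow> real" and g :: "(nat \<Rightarrow> real) \<Rightarrow> (nat \<Rightarrow> real)"
    and \<alpha> \<beta> L :: real
  assumes cont: "continuous_on UNIV G"
    and even: "G (- x) = G x"
    and gradient_in_Rn: "x \<in> Rn d \<Longrightarrow> g x \<in> Rn d"
    and alpha_pos: "\<alpha> > 0"
    and lower: "\<lbrakk>x \<in> Rn d; y \<in> Rn d\<rbrakk> \<Longrightarrow> G x + dotp d (g x) (y - x) + \<alpha> * dotp d (y - x) (y - x) \<le> G y"
    and upper: "\<lbrakk>x \<in> Rn d; y \<in> Rn d\<rbrakk> \<Longrightarrow> G y \<le> G x + dotp d (g x) (y - x) + \<beta> * dotp d (y - x) (y - x)"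
    and level: "G 0 < L"
begin

definition sublevel where "sublevel = {x \<in> Rn d. G x \<le> L}"

text \<open>
  Evenness makes the linear terms of the lower paraboloids at the origin, taken in the directions
  \<^term>\<open>x\<close> and \<^term>\<open>- x\<close>, cancel.
\<close>

lemma coercive: "x \<in> Rn d \<Longrightarrow> G 0 + \<alpha> * dotp d x x \<le> G x"
  using lower[of 0 x] lower[of 0 "- x"] even[of x] by (simp add: Rn_closed dotp_linear)

lemma strong_convexity:
  assumes "x \<in> Rn d" "y \<in> Rn d" "u \<ge> 0" "v \<ge> 0" "u + v = 1"
  shows "G (u *\<^sub>R x + v *\<^sub>R y) + \<alpha> * (u * v) * dotp d (x - y) (x - y) \<le> u * G x + v * G y"
proof -
  define z where "z = u *\<^sub>R x + v *\<^sub>R y"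
  have z: "z \<in> Rn d" using assms by (auto simp: z_def intro!: Rn_closed)
  have u: "u = 1 - v" using assms by simp
  have xz: "x - z = v *\<^sub>R (x - y)" and yz: "y - z = (- u) *\<^sub>R (x - y)"
    unfolding z_def u by (auto simp: scaleR_fun_def fun_eq_iff algebra_simps)
  let ?D = "dotp d (x - y) (x - y)" and ?h = "dotp d (g z) (x - y)"
  have "u * (G z + v * ?h + \<alpha> * (v * (v * ?D))) \<le> u * G x"
    using lower[OF z assms(1)] assms(3) unfolding xz dotp_scaleR_left dotp_scaleR_right
    by (intro mult_left_mono)
  moreover have "v * (G z + (- u) * ?h + \<alpha> * ((-u) * ((-u) * ?D))) \<le> v * G y"
    using lower[OF z assms(2)] assms(4) unfolding yz dotp_scaleR_left dotp_scaleR_right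
    by (intro mult_left_mono)
  ultimately have "u * (G z + v * ?h + \<alpha> * (v * (v * ?D))) +
      v * (G z + (- u) * ?h + \<alpha> * ((-u) * ((-u) * ?D))) \<le> u * G x + v * G y"
    by linarith
  also have "u * (G z + v * ?h + \<alpha> * (v * (v * ?D))) + v * (G z + (- u) * ?h + \<alpha> * ((-u) * ((-u) * ?D)))
      = (u + v) * G z + \<alpha> * (u * v) * ((u + v) * ?D)" by (simp add: algebra_simps)
  finally show ?thesis using assms(5) by (simp add: z_def)
qed

lemma sublevel_subset_Rn: "sublevel \<subseteq> Rn d"
  by (auto simp: sublevel_def)

lemma uminus_sublevel: "x \<in> sublevel \<Longrightarrow> - x \<in> sublevel"
  by (simp add: sublevel_def even Rn_closed)

lemma closedin_sublevel: "closedin (Euclidean_space d) sublevel"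
proof -
  have "closed {x. G x \<le> L}" by (intro closed_Collect_le cont continuous_intros)
  moreover have "closed (Rn d)" using closedin_Euclidean_space_iff[of d "Rn d"] by simp
  ultimately have "closed (Rn d \<inter> {x. G x \<le> L})" by (simp add: closed_Int)
  then show ?thesis unfolding closedin_Euclidean_space_iff by (auto simp: sublevel_def Int_def)
qed

lemma compactin_sublevel: "compactin (Euclidean_space d) sublevel"
proof -
  define R where "R = sqrt ((L - G 0) / \<alpha>)"
  define box :: "(nat \<Rightarrow> real) set" where "box = Pi\<^sub>E UNIV (\<lambda>_. {-R..R})"
  have "sublevel \<subseteq> box"
  proof
    fix x assume x: "x \<in> sublevel"
    have "x i \<in> {-R..R}" for i
    proof (cases "i < d")
      case True
      have "(x i)\<^sup>2 \<le> dotp d x x"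
        unfolding dotp_def power2_eq_square using True
        by (intro member_le_sum[of i "{..<d}" "\<lambda>i. x i * x i"]) auto
      also have "\<dots> \<le> (L - G 0) / \<alpha>"
        using coercive[of x] x alpha_pos by (simp add: sublevel_def field_simps)
      finally have "\<bar>x i\<bar> \<le> R" unfolding R_def by (rule real_le_rsqrt[of "\<bar>x i\<bar>", simplified])
      then show ?thesis by auto
    next
      case False
      then have "x i = 0" using x by (simp add: sublevel_def topspace_Euclidean_space)
      then show ?thesis using level alpha_pos by (simp add: R_def)
    qed
    then show "x \<in> box" by (simp add: box_def PiE_iff)
  qed
  moreover have "compactin (powertop_real UNIV) box"
    by (simp add: box_def compactin_PiE)
  moreover have "closedin (powertop_real UNIV) sublevel"
    using closedin_sublevel by (simp add: closedin_Euclidean_space_iff euclidean_product_topology)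
  ultimately have "compactin (powertop_real UNIV) sublevel" using closed_compactin by blast
  then show ?thesis using sublevel_subset_Rn unfolding topspace_Euclidean_space
    unfolding Euclidean_space_def compactin_subtopology by blast
qed

lemma convex_sublevel: "convex sublevel"
proof (rule convexI)
  fix x y and u v :: real
  assume xy: "x \<in> sublevel" "y \<in> sublevel" and uv: "0 \<le> u" "0 \<le> v" "u + v = 1"
  then have "x \<in> Rn d" "y \<in> Rn d" by (auto simp: sublevel_def)
  have "\<alpha> * (u * v) * dotp d (x - y) (x - y) \<ge> 0"
    using alpha_pos uv by (simp add: dotp_self_nonneg)
  moreover have "u * G x + v * G y \<le> L"
    using xy uv by (intro convex_bound_le) (auto simp: sublevel_def)
  ultimately show "u *\<^sub>R x + v *\<^sub>R y \<in> sublevel"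
    using strong_convexity[OF \<open>x \<in> Rn d\<close> \<open>y \<in> Rn d\<close> uv] \<open>x \<in> Rn d\<close> \<open>y \<in> Rn d\<close>
    by (auto simp: sublevel_def intro!: Rn_closed)
qed

lemma strict_sublevel_interior: "x \<in> Rn d \<Longrightarrow> G x < L \<Longrightarrow> x \<in> Euclidean_space d interior_of sublevel"
proof -
  have "open {x. G x < L}" by (intro open_Collect_less cont continuous_intros)
  then have "openin (powertop_real UNIV) {x. G x < L}" by (simp add: euclidean_product_topology)
  then have "openin (Euclidean_space d) ({x. G x < L} \<inter> {x. \<forall>i\<ge>d. x i = 0})"
    unfolding Euclidean_space_def openin_subtopology by blast
  then have "{x. G x < L} \<inter> {x. \<forall>i\<ge>d. x i = 0} \<subseteq> Euclidean_space d interior_of sublevel"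
    by (intro interior_of_maximal) (auto simp: sublevel_def topspace_Euclidean_space)
  then show "x \<in> Rn d \<Longrightarrow> G x < L \<Longrightarrow> x \<in> Euclidean_space d interior_of sublevel"
    by (auto simp: topspace_Euclidean_space)
qed

lemma sublevel_is_convex_body: "convex_body d sublevel"
  using compactin_sublevel convex_sublevel strict_sublevel_interior[OF Rn_closed(1) level]
  by (auto simp: convex_body_def)

lemma frontier_sublevel:
  assumes "p \<in> Euclidean_space d frontier_of sublevel"
  shows "p \<in> Rn d" "G p = L"
proof -
  have "p \<in> sublevel" using frontier_of_subset_closedin[OF closedin_sublevel] assms by auto
  then show p: "p \<in> Rn d" by (simp add: sublevel_def)
  have "p \<notin> Euclidean_space d interior_of sublevel" using assms by (simp add: frontier_of_def)
  then have "\<not> G p < L" using strict_sublevel_interior[OF p] by blast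
  then show "G p = L" using \<open>p \<in> sublevel\<close> by (simp add: sublevel_def)
qed

lemma sublevel_is_strictly_convex: "strictly_convex d sublevel"
  unfolding strictly_convex_def
proof (intro notI, elim exE conjE)
  fix x y :: "nat \<Rightarrow> real"
  assume "x \<noteq> y" and seg: "closed_segment x y \<subseteq> Euclidean_space d frontier_of sublevel"
  have "x \<in> Euclidean_space d frontier_of sublevel" "y \<in> Euclidean_space d frontier_of sublevel"
    using seg by auto
  note x = frontier_sublevel[OF this(1)] and y = frontier_sublevel[OF this(2)]
  have "(1/2) *\<^sub>R x + (1/2) *\<^sub>R y \<in> closed_segment x y"
    unfolding closed_segment_def by (intro CollectI exI[of _ "1/2"]) auto
  then have "G ((1/2) *\<^sub>R x + (1/2) *\<^sub>R y) = L" using frontier_sublevel(2) seg by blast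
  then have "\<alpha> * dotp d (x - y) (x - y) \<le> 0"
    using strong_convexity[of x y "1/2" "1/2"] x y by simp
  moreover have "dotp d (x - y) (x - y) > 0"
    using dotp_self_pos[of "x - y" d] x y \<open>x \<noteq> y\<close> by (auto intro!: Rn_closed)
  ultimately show False using alpha_pos by (simp add: mult_le_0_iff)
qed

lemma gradient_supports:
  assumes "p \<in> Rn d" "G p = L" "x \<in> sublevel"
  shows "dotp d (g p) x \<le> dotp d (g p) p"
proof -
  have "G p + dotp d (g p) (x - p) + \<alpha> * dotp d (x - p) (x - p) \<le> L"
    using lower[of p x] assms by (simp add: sublevel_def)
  then show ?thesis using assms(2) alpha_pos dotp_self_nonneg[of d "x - p"]
    by (simp add: dotp_linear) (smt (verit) mult_nonneg_nonneg)
qed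

lemma gradient_pos:
  assumes "p \<in> Rn d" "G p = L"
  shows "dotp d (g p) p > 0"
  using lower[OF assms(1) Rn_closed(1)] level assms(2) alpha_pos dotp_self_nonneg[of d p]
  by (simp add: dotp_linear) (smt (verit) mult_nonneg_nonneg)

lemma descent_direction_enters_sublevel:
  assumes p: "p \<in> Rn d" "G p = L" and v: "v \<in> Rn d" and descent: "dotp d (g p) v < 0"
  obtains t where "t > 0" "p + t *\<^sub>R v \<in> sublevel"
proof
  \<comment> \<open>With this step length the quadratic error is at most the linear gain; the summand 1 keeps the
    denominator positive.\<close>
  define q where "q = \<bar>\<beta>\<bar> * dotp d v v + 1"
  have "q > 0" unfolding q_def by (smt (verit) abs_ge_zero dotp_self_nonneg mult_nonneg_nonneg)
  define t where "t = - dotp d (g p) v / q"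
  show "t > 0" using descent \<open>q > 0\<close> by (simp add: t_def divide_neg_pos)
  have "G (p + t *\<^sub>R v) \<le> L + t * dotp d (g p) v + (\<beta> * dotp d v v) * (t * t)"
    using upper[of p "p + t *\<^sub>R v"] p v by (simp add: Rn_closed dotp_linear algebra_simps)
  moreover have "(\<beta> * dotp d v v) * (t * t) \<le> q * (t * t)"
    unfolding q_def using dotp_self_nonneg[of d v]
    by (intro mult_right_mono) (auto intro: order_trans[OF mult_right_mono[of \<beta> "\<bar>\<beta>\<bar>"]])
  moreover have "t * dotp d (g p) v + q * (t * t) = 0"
    using \<open>q > 0\<close> by (simp add: t_def field_simps)
  ultimately have "G (p + t *\<^sub>R v) \<le> L" by linarith
  moreover have "p + t *\<^sub>R v \<in> Rn d" using p v by (intro Rn_closed)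
  ultimately show "p + t *\<^sub>R v \<in> sublevel" unfolding sublevel_def by blast
qed

text \<open>
  Every direction with negative derivative leads into the sublevel set, so it has nonpositive
  product with a supporting normal \<^term>\<open>a\<close>. By passing to the limit this also holds for directions
  orthogonal to the gradient, in particular for the component \<^term>\<open>w\<close> of \<^term>\<open>a\<close> orthogonal to
  the gradient, which therefore vanishes.
\<close>

lemma supporting_normal_parallel_gradient:
  assumes p: "p \<in> Rn d" "G p = L" and a: "a \<in> Rn d"
    and supp: "\<And>x. x \<in> sublevel \<Longrightarrow> dotp d a x \<le> dotp d a p"
  obtains c where "a = c *\<^sub>R g p"
proof
  let ?h = "g p"
  have h: "?h \<in> Rn d" using gradient_in_Rn p by simp
  have "?h \<noteq> 0" using gradient_pos[OF p] by (auto simp: dotp_linear)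
  then have hh: "dotp d ?h ?h > 0" using dotp_self_pos[OF h] by simp
  define c where "c = dotp d a ?h / dotp d ?h ?h"
  define w where "w = a - c *\<^sub>R ?h"
  have w: "w \<in> Rn d" using a h by (simp add: w_def Rn_closed)
  have "dotp d ?h w = 0" using hh by (simp add: w_def dotp_linear c_def dotp_commute)
  have *: "dotp d a w \<le> s * dotp d a ?h" if "s > 0" for s
  proof -
    have "dotp d ?h (w - s *\<^sub>R ?h) < 0" using \<open>dotp d ?h w = 0\<close> hh that by (simp add: dotp_linear)
    then obtain t where t: "t > 0" "p + t *\<^sub>R (w - s *\<^sub>R ?h) \<in> sublevel"
      using descent_direction_enters_sublevel[OF p] w h by (metis Rn_closed(3,5))
    then have "t * dotp d a (w - s *\<^sub>R ?h) \<le> 0" using supp[OF t(2)] by (simp add: dotp_linear)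
    then show ?thesis using t(1) by (simp add: mult_le_0_iff dotp_linear)
  qed
  have "dotp d a w \<le> 0"
  proof (rule field_le_epsilon)
    fix e :: real assume "e > 0"
    have "dotp d a w \<le> e / (\<bar>dotp d a ?h\<bar> + 1) * dotp d a ?h"
      using \<open>e > 0\<close> by (intro *) (simp add: add_nonneg_pos)
    also have "\<dots> \<le> e"
      using \<open>e > 0\<close> by (simp add: pos_divide_le_eq add_nonneg_pos)
    finally show "dotp d a w \<le> 0 + e" by simp
  qed
  moreover have "dotp d a w = dotp d w w"
  proof -
    have "dotp d a w = dotp d (w + c *\<^sub>R ?h) w" by (simp add: w_def)
    also have "\<dots> = dotp d w w" using \<open>dotp d ?h w = 0\<close> by (simp add: dotp_linear)
    finally show ?thesis .
  qed
  ultimately have "w = 0" using dotp_self_pos[OF w] by fastforce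
  then show "a = c *\<^sub>R g p" by (simp add: w_def)
qed

lemma sublevel_is_smooth: "smooth_body d sublevel"
  unfolding smooth_body_def
proof
  fix p assume "p \<in> Euclidean_space d frontier_of sublevel"
  note p = frontier_sublevel[OF this]
  let ?h = "g p"
  have "?h \<noteq> 0" using gradient_pos[OF p] by (auto simp: dotp_linear)
  show "\<exists>!H. supporting_hyperplane d sublevel p H"
  proof (rule ex1I)
    show "supporting_hyperplane d sublevel p (hyperplane d ?h (dotp d ?h p))"
      unfolding supporting_hyperplane_def using p gradient_in_Rn[OF p(1)] \<open>?h \<noteq> 0\<close> gradient_supports[OF p]
      by (intro bexI[of _ ?h] exI[of _ "dotp d ?h p"]) (auto simp: hyperplane_def)
  next
    fix H assume "supporting_hyperplane d sublevel p H"
    then obtain a b where a: "a \<in> Rn d" "a \<noteq> 0" "H = hyperplane d a b" "p \<in> H"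
      "\<And>x. x \<in> sublevel \<Longrightarrow> dotp d a x \<le> b" unfolding supporting_hyperplane_def by blast
    then have b: "b = dotp d a p" by (simp add: hyperplane_def)
    obtain c where c: "a = c *\<^sub>R ?h"
      using supporting_normal_parallel_gradient[OF p a(1)] a(5) b by blast
    then have "c \<noteq> 0" using a(2) by auto
    then show "H = hyperplane d ?h (dotp d ?h p)"
      unfolding a(3) b by (auto simp: c hyperplane_def dotp_linear)
  qed
qed

end

section \<open>Smooth and strictly convex bodies from obtuse systems\<close>

text \<open>
  Soft thresholding: the signed distance of \<^term>\<open>s\<close> from the interval between \<^term>\<open>- t\<close> and \<^term>\<open>t\<close>.
  Its square is a convex function of \<^term>\<open>s\<close> that vanishes on this interval and has the Lipschitz
  continuous derivative \<^term>\<open>2 * shrink t s\<close>.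
\<close>

definition shrink :: "real \<Rightarrow> real \<Rightarrow> real"
  where "shrink t s = s - max (- t) (min s t)"

lemma shrink_eq_0: "\<bar>s\<bar> \<le> t \<Longrightarrow> shrink t s = 0"
  by (auto simp: shrink_def)

lemma shrink_uminus: "t \<ge> 0 \<Longrightarrow> shrink t (- s) = - shrink t s"
  by (auto simp: shrink_def)

lemma shrink_square_above_tangent:
  assumes "t \<ge> 0"
  shows "(shrink t s)\<^sup>2 + 2 * shrink t s * (r - s) \<le> (shrink t r)\<^sup>2"
proof -
  let ?c = "\<lambda>s. max (- t) (min s t)"
  have "shrink t s * (?c s - ?c r) \<ge> 0"
    using assms by (auto simp: shrink_def zero_le_mult_iff max_def min_def)
  moreover have "(shrink t r)\<^sup>2 = (shrink t s)\<^sup>2 + 2 * shrink t s * (r - s)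
      + (shrink t r - shrink t s)\<^sup>2 + 2 * (shrink t s * (?c s - ?c r))"
    by (simp add: shrink_def power2_eq_square algebra_simps)
  ultimately show ?thesis by (smt (verit) zero_le_power2)
qed

text \<open>
  The parabola on the right is the squared distance of \<^term>\<open>r\<close> from the point of the interval
  nearest to \<^term>\<open>s\<close>, hence at least the squared distance from the interval.
\<close>

lemma shrink_square_below_parabola:
  assumes "t \<ge> 0"
  shows "(shrink t r)\<^sup>2 \<le> (shrink t s)\<^sup>2 + 2 * shrink t s * (r - s) + (r - s)\<^sup>2"
proof -
  have "\<bar>shrink t r\<bar> \<le> \<bar>r - max (- t) (min s t)\<bar>"
    using assms by (auto simp: shrink_def max_def min_def)
  then have "(shrink t r)\<^sup>2 \<le> (r - max (- t) (min s t))\<^sup>2" by (simp add: abs_le_square_iff)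
  also have "\<dots> = (shrink t s)\<^sup>2 + 2 * shrink t s * (r - s) + (r - s)\<^sup>2"
    by (simp add: shrink_def power2_eq_square algebra_simps)
  finally show ?thesis .
qed

lemma dotp_sum_left: "dotp d (sum h S) x = (\<Sum>p\<in>S. dotp d (h p) x)"
  by (induction S rule: infinite_finite_induct) (simp_all only: sum.infinite sum.empty sum.insert dotp_linear not_False_eq_True)

lemma dotp_Cauchy_Schwarz: "(dotp d x y)\<^sup>2 \<le> dotp d x x * dotp d y y"
  using Cauchy_Schwarz_ineq_sum[of x y "{..<d}"] by (simp add: dotp_def power2_eq_square)

lemma finite_uniform_gap:
  fixes M :: "'i \<Rightarrow> 'i \<Rightarrow> real"
  assumes "finite S" "\<And>p q. p \<in> S \<Longrightarrow> q \<in> S \<Longrightarrow> p \<noteq> q \<Longrightarrow> -1 < M p q \<and> M p q < 0"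
  obtains \<delta> where "0 < \<delta>" "\<delta> \<le> 1"
    "\<And>p q. p \<in> S \<Longrightarrow> q \<in> S \<Longrightarrow> p \<noteq> q \<Longrightarrow> -(1 - \<delta>) \<le> M p q \<and> M p q \<le> - \<delta>"
proof
  define D where "D = insert 1 ((\<lambda>(p, q). min (1 + M p q) (- M p q)) ` {(p, q) \<in> S \<times> S. p \<noteq> q})"
  have "finite {(p, q) \<in> S \<times> S. p \<noteq> q}"
    by (rule finite_subset[of _ "S \<times> S"]) (use assms(1) in auto)
  then have "finite D" "D \<noteq> {}" by (auto simp: D_def)
  show "0 < Min D" using \<open>finite D\<close> \<open>D \<noteq> {}\<close> assms(2) by (subst Min_gr_iff) (force simp: D_def)+
  show "Min D \<le> 1" using \<open>finite D\<close> by (intro Min_le) (auto simp: D_def)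
  show "-(1 - Min D) \<le> M p q \<and> M p q \<le> - Min D" if "p \<in> S" "q \<in> S" "p \<noteq> q" for p q
  proof -
    have "min (1 + M p q) (- M p q) \<in> D" using that by (auto simp: D_def)
    then have "Min D \<le> min (1 + M p q) (- M p q)" using Min_le[OF \<open>finite D\<close>] by blast
    then show ?thesis by linarith
  qed
qed

text \<open>
  The body is a sublevel set of the sum of the squares of \<^term>\<open>shrink t (dotp d (f p) x)\<close> and a small
  multiple of the squared norm. With a threshold \<^term>\<open>t\<close> that no off-diagonal value exceeds in modulus, only the
  term of \<^term>\<open>p\<close> is active at \<^term>\<open>u p\<close>, so the gradient there is a positive multiple of
  \<^term>\<open>f p\<close> up to a small multiple of \<^term>\<open>u p\<close>. Since the off-diagonal values are bounded away
  from 0, this perturbation keeps the gradient at \<^term>\<open>u p\<close> nonpositive at all other \<^term>\<open>u q\<close>.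
  Equal lengths put all the \<^term>\<open>u p\<close> on the same level set.
\<close>

lemma body_from_obtuse_system:
  fixes f u :: "'i \<Rightarrow> nat \<Rightarrow> real"
  assumes "finite S" "\<rho> \<ge> 0"
    and f: "\<And>p. p \<in> S \<Longrightarrow> f p \<in> Rn d" and u: "\<And>p. p \<in> S \<Longrightarrow> u p \<in> Rn d"
    and diag: "\<And>p. p \<in> S \<Longrightarrow> dotp d (f p) (u p) = 1"
    and off: "\<And>p q. p \<in> S \<Longrightarrow> q \<in> S \<Longrightarrow> p \<noteq> q \<Longrightarrow>
      -1 < dotp d (f p) (u q) \<and> dotp d (f p) (u q) < 0"
    and len: "\<And>p. p \<in> S \<Longrightarrow> dotp d (u p) (u p) = \<rho>"
  shows "\<exists>K. convex_body d K \<and> smooth_body d K \<and> strictly_convex d K \<and> card S \<le> H_sep d K"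
proof -
  obtain \<delta> where \<delta>: "0 < \<delta>" "\<delta> \<le> 1" and gap: "\<And>p q. p \<in> S \<Longrightarrow> q \<in> S \<Longrightarrow> p \<noteq> q \<Longrightarrow>
      -(1 - \<delta>) \<le> dotp d (f p) (u q) \<and> dotp d (f p) (u q) \<le> - \<delta>"
    using finite_uniform_gap[of S "\<lambda>p q. dotp d (f p) (u q)", OF assms(1) off] by blast
  define t where "t = 1 - \<delta>"
  have "t \<ge> 0" using \<delta> by (simp add: t_def)
  \<comment> \<open>Chosen such that \<^term>\<open>\<epsilon> * \<rho>\<close> is at most \<^term>\<open>\<delta>\<^sup>2\<close>, the margin gained from the active term.\<close>
  define \<epsilon> where "\<epsilon> = \<delta>\<^sup>2 / (\<rho> + 1)"
  have "\<epsilon> > 0" using \<delta> \<open>\<rho> \<ge> 0\<close> by (simp add: \<epsilon>_def)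
  have "\<epsilon> * \<rho> \<le> \<delta>\<^sup>2" using \<open>\<rho> \<ge> 0\<close> by (simp add: \<epsilon>_def pos_divide_le_eq mult_left_mono)
  define G where "G x = (\<Sum>p\<in>S. (shrink t (dotp d (f p) x))\<^sup>2) + \<epsilon> * dotp d x x" for x
  define g where "g x = (\<Sum>p\<in>S. (2 * shrink t (dotp d (f p) x)) *\<^sub>R f p) + (2 * \<epsilon>) *\<^sub>R x" for x
  define \<beta> where "\<beta> = (\<Sum>p\<in>S. dotp d (f p) (f p)) + \<epsilon>"
  define L where "L = \<delta>\<^sup>2 + \<epsilon> * \<rho>"
  have g_dot: "dotp d (g x) y = (\<Sum>p\<in>S. 2 * shrink t (dotp d (f p) x) * dotp d (f p) y) + 2 * \<epsilon> * dotp d x y"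
    for x y by (simp add: g_def dotp_linear dotp_sum_left)
  have sq: "dotp d y y = dotp d x x + 2 * dotp d x (y - x) + dotp d (y - x) (y - x)" for x y
    by (simp add: dotp_linear dotp_commute)
  interpret pinched_even_function d G g \<epsilon> \<beta> L
  proof
    show "continuous_on UNIV G"
      unfolding G_def dotp_def shrink_def by (intro continuous_intros continuous_on_product_coordinates)
    show "G (- x) = G x" for x by (simp add: G_def dotp_linear shrink_uminus \<open>t \<ge> 0\<close>)
    show "g x \<in> Rn d" if "x \<in> Rn d" for x
    proof -
      have "(\<Sum>p\<in>S. c p *\<^sub>R f p) \<in> Rn d" for c
        using \<open>finite S\<close> f by (induction S) (auto intro!: Rn_closed)
      then show ?thesis using that by (simp add: g_def Rn_closed)
    qed
    show "0 < \<epsilon>" by fact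
    show "G 0 < L" using \<open>\<epsilon> > 0\<close> \<open>\<rho> \<ge> 0\<close> \<delta>(1) \<open>t \<ge> 0\<close>
      by (simp add: G_def L_def dotp_linear shrink_eq_0 add_pos_nonneg)
    show "G x + dotp d (g x) (y - x) + \<epsilon> * dotp d (y - x) (y - x) \<le> G y" for x y
    proof -
      have "(\<Sum>p\<in>S. (shrink t (dotp d (f p) x))\<^sup>2 + 2 * shrink t (dotp d (f p) x) * dotp d (f p) (y - x))
          \<le> (\<Sum>p\<in>S. (shrink t (dotp d (f p) y))\<^sup>2)"
        unfolding dotp_diff_right by (intro sum_mono shrink_square_above_tangent \<open>t \<ge> 0\<close>)
      then show ?thesis unfolding G_def g_dot sum.distrib sq[of y x] by (simp add: algebra_simps)
    qed
    show "G y \<le> G x + dotp d (g x) (y - x) + \<beta> * dotp d (y - x) (y - x)" for x y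
    proof -
      have "(\<Sum>p\<in>S. (shrink t (dotp d (f p) y))\<^sup>2) \<le>
        (\<Sum>p\<in>S. (shrink t (dotp d (f p) x))\<^sup>2 + 2 * shrink t (dotp d (f p) x) * dotp d (f p) (y - x)
           + dotp d (f p) (f p) * dotp d (y - x) (y - x))"
      proof (rule sum_mono)
        fix p
        show "(shrink t (dotp d (f p) y))\<^sup>2 \<le> (shrink t (dotp d (f p) x))\<^sup>2
           + 2 * shrink t (dotp d (f p) x) * dotp d (f p) (y - x)
           + dotp d (f p) (f p) * dotp d (y - x) (y - x)"
          using shrink_square_below_parabola[OF \<open>t \<ge> 0\<close>, of "dotp d (f p) y" "dotp d (f p) x"]
            dotp_Cauchy_Schwarz[of d "f p" "y - x"]
          unfolding dotp_diff_right[of d "f p"] by linarith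
      qed
      then show ?thesis
        unfolding G_def g_dot sum.distrib sq[of y x] \<beta>_def sum_distrib_right[symmetric]
        by (simp add: algebra_simps)
    qed
  qed
  have others: "shrink t (dotp d (f q) (u p)) = (if q = p then \<delta> else 0)" if "p \<in> S" "q \<in> S" for p q
    using gap[of q p] that diag[of p] \<delta> by (auto simp: shrink_eq_0 t_def shrink_def)
  have G_u: "G (u p) = L" if "p \<in> S" for p
    using that \<open>finite S\<close> by (simp add: G_def L_def others len if_distrib[of "\<lambda>x. x\<^sup>2"] cong: if_cong)
  have g_u: "dotp d (g (u p)) x = 2 * \<delta> * dotp d (f p) x + 2 * \<epsilon> * dotp d (u p) x" if "p \<in> S" for p x
  proof -
    have "(\<Sum>q\<in>S. 2 * shrink t (dotp d (f q) (u p)) * dotp d (f q) x)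
        = (\<Sum>q\<in>S. if q = p then 2 * \<delta> * dotp d (f q) x else 0)"
      by (intro sum.cong refl) (simp add: others that)
    then show ?thesis using that \<open>finite S\<close> by (simp add: g_dot)
  qed
  have "inj_on u S"
    using diag off by (intro inj_onI) (metis less_irrefl order_less_trans zero_less_one)
  then have "card S = card (u ` S)" by (simp add: card_image)
  also have "\<dots> \<le> H_sep d sublevel"
  proof (rule H_sep_ge_card[where a = g])
    show "u ` S \<subseteq> sublevel" using u G_u by (auto simp: sublevel_def)
    show "dotp d (g v) w \<le> 0" if vw: "v \<in> u ` S" "w \<in> u ` S" "v \<noteq> w" for v w
    proof -
      obtain p q where pq: "p \<in> S" "q \<in> S" "p \<noteq> q" "v = u p" "w = u q" using vw by auto
      have "dotp d (u p) (u q) \<le> \<rho>"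
        using dotp_self_nonneg[of d "u p - u q"] len[OF pq(1)] len[OF pq(2)]
        by (simp add: dotp_linear dotp_commute)
      then have "\<epsilon> * dotp d (u p) (u q) \<le> \<delta>\<^sup>2"
        using \<open>\<epsilon> * \<rho> \<le> \<delta>\<^sup>2\<close> \<open>\<epsilon> > 0\<close> by (meson mult_left_mono less_imp_le order_trans)
      moreover have "\<delta> * dotp d (f p) (u q) \<le> \<delta> * (- \<delta>)"
        using gap[OF pq(1-3)] \<delta> by (intro mult_left_mono) auto
      ultimately show ?thesis using pq by (simp add: g_u power2_eq_square)
    qed
  qed (use \<open>finite S\<close> u G_u gradient_in_Rn gradient_pos gradient_supports uminus_sublevel sublevel_is_convex_body
        in auto)
  finally show ?thesis
    using sublevel_is_convex_body sublevel_is_smooth sublevel_is_strictly_convex by blast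
qed


section \<open>Almost orthogonal unit vectors\<close>

lemma distr_PiM_lborel_translation:
  assumes "finite I"
  shows "distr (Pi\<^sub>M I (\<lambda>_. lborel)) (Pi\<^sub>M I (\<lambda>_. lborel)) (\<lambda>x. \<lambda>i\<in>I. x i + c i) = Pi\<^sub>M I (\<lambda>_. lborel :: real measure)"
proof -
  interpret product_sigma_finite "\<lambda>_. lborel :: real measure" by standard
  let ?M = "Pi\<^sub>M I (\<lambda>_. lborel :: real measure)" and ?T = "\<lambda>x. \<lambda>i\<in>I. x i + c i"
  have meas [measurable]: "?T \<in> measurable ?M ?M"
    by (rule measurable_restrict) measurable
  show ?thesis
  proof (rule PiM_eqI[OF assms])
    show "sets (distr ?M ?M ?T) = sets ?M" by simp
  next
    fix A :: "'a \<Rightarrow> real set" assume A: "\<And>i. i \<in> I \<Longrightarrow> A i \<in> sets lborel"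
    have shift: "{y. y + c i \<in> A i} \<in> sets lborel" if "i \<in> I" for i
    proof -
      have "(\<lambda>y. y + c i) -` A i \<inter> space lborel \<in> sets lborel"
        by (rule measurable_sets[of _ lborel lborel]) (use A that in auto)
      then show ?thesis by (simp add: vimage_def)
    qed
    have "emeasure (distr ?M ?M ?T) (Pi\<^sub>E I A) = emeasure ?M (?T -` Pi\<^sub>E I A \<inter> space ?M)"
      using A assms by (intro emeasure_distr meas sets_PiM_I_finite) auto
    also have "?T -` Pi\<^sub>E I A \<inter> space ?M = Pi\<^sub>E I (\<lambda>i. {y. y + c i \<in> A i})"
      by (auto simp: space_PiM PiE_def Pi_def extensional_def)
    also have "emeasure ?M \<dots> = (\<Prod>i\<in>I. emeasure lborel {y. y + c i \<in> A i})"
      using shift assms by (intro emeasure_PiM) auto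
    also have "\<dots> = (\<Prod>i\<in>I. emeasure lborel (A i))"
    proof (rule prod.cong[OF refl])
      fix i assume i: "i \<in> I"
      have "emeasure lborel (A i) = emeasure (distr lborel borel (\<lambda>y. c i + y)) (A i)"
        using lborel_affine[of 1 "c i"] by (simp add: density_1)
      also have "\<dots> = emeasure lborel {y. y + c i \<in> A i}"
        using A[OF i] by (subst emeasure_distr) (auto simp: vimage_def add.commute)
      finally show "emeasure lborel {y. y + c i \<in> A i} = emeasure lborel (A i)" ..
    qed
    finally show "emeasure (distr ?M ?M ?T) (Pi\<^sub>E I A) = (\<Prod>i\<in>I. emeasure lborel (A i))" .
  qed
qed

lemma emeasure_PiM_cball:
  assumes "finite I" "r > 0"
  shows "emeasure (Pi\<^sub>M I (\<lambda>_. lborel)) {x \<in> space (Pi\<^sub>M I (\<lambda>_. lborel)). (\<Sum>i\<in>I. (x i - c i)\<^sup>2) \<le> r\<^sup>2}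
    = ennreal (unit_ball_vol (real (card I)) * r ^ card I)"
proof -
  let ?M = "Pi\<^sub>M I (\<lambda>_. lborel :: real measure)" and ?T = "\<lambda>x. \<lambda>i\<in>I. x i + - c i"
  let ?B = "{f. sqrt (\<Sum>i\<in>I. (f i)\<^sup>2) \<le> r} \<inter> space ?M"
  have meas [measurable]: "?T \<in> measurable ?M ?M"
    by (rule measurable_restrict) measurable
  have B: "?B \<in> sets ?M" by auto
  have "emeasure ?M ?B = emeasure (distr ?M ?M ?T) ?B"
    using distr_PiM_lborel_translation[OF assms(1), of "\<lambda>i. - c i"] by simp
  also have "\<dots> = emeasure ?M (?T -` ?B \<inter> space ?M)"
    using meas B by (rule emeasure_distr)
  also have "?T -` ?B \<inter> space ?M = {x \<in> space ?M. (\<Sum>i\<in>I. (x i - c i)\<^sup>2) \<le> r\<^sup>2}"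
    using \<open>r > 0\<close>
    by (auto simp: space_PiM real_sqrt_le_iff' sum_nonneg intro!: sum_nonneg)
  finally show ?thesis using emeasure_cball_aux[OF assms] by simp
qed

text \<open>
  A volume argument. The cone of all \<^term>\<open>x\<close> in the unit ball that make an angle of cosine at least
  1/3 with \<^term>\<open>p\<close> or \<^term>\<open>- p\<close> is covered by the two balls of radius \<open>sqrt 8 / 3\<close> around
  \<open>p / 3\<close> and \<open>- p / 3\<close>: the rim of the corresponding spherical cap has exactly this
  distance from \<open>p / 3\<close>, and the origin is closer. If the total volume of all these balls is
  smaller than that of the unit ball, some point of the unit ball escapes, and it can be
  normalised.
\<close>

lemma sphere_point_outside_caps:
  fixes S :: "(nat \<Rightarrow> real) set"
  assumes "finite S" "S \<noteq> {}"
    and unit: "\<And>p. p \<in> S \<Longrightarrow> (\<Sum>i<m. (p i)\<^sup>2) = 1"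
    and small: "2 * real (card S) * (sqrt 8 / 3) ^ m < 1"
  obtains x where "(\<Sum>i<m. (x i)\<^sup>2) = 1" "\<And>i. i \<ge> m \<Longrightarrow> x i = 0"
    "\<And>p. p \<in> S \<Longrightarrow> \<bar>\<Sum>i<m. p i * x i\<bar> < 1/3"
proof -
  let ?M = "Pi\<^sub>M {..<m} (\<lambda>_. lborel :: real measure)"
  define ball where "ball r c = {x \<in> space ?M. (\<Sum>i<m. (x i - c i)\<^sup>2) \<le> r\<^sup>2}" for r :: real and c
  define \<rho> where "\<rho> = sqrt 8 / (3::real)"
  define V where "V = unit_ball_vol (real m)"
  have "V > 0" by (simp add: V_def)
  have "\<rho> > 0" "\<rho>\<^sup>2 = 8/9" by (auto simp: \<rho>_def power_divide)
  have ball_sets [measurable]: "ball r c \<in> sets ?M" for r c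
    unfolding ball_def by measurable
  have vol: "emeasure ?M (ball r c) = ennreal (V * r ^ m)" if "r > 0" for r c
    unfolding ball_def V_def using emeasure_PiM_cball[of "{..<m}" r c] that by simp
  define C where "C = (\<Union>p\<in>S. \<Union>s\<in>{1/3,-1/3}. ball \<rho> (\<lambda>i. s * p i))"
  have "emeasure ?M C \<le> (\<Sum>p\<in>S. emeasure ?M (\<Union>s\<in>{1/3,-1/3}. ball \<rho> (\<lambda>i. s * p i)))"
    unfolding C_def using \<open>finite S\<close> by (intro emeasure_subadditive_finite) auto
  also have "\<dots> \<le> (\<Sum>p\<in>S. \<Sum>s\<in>{1/3,-1/3::real}. emeasure ?M (ball \<rho> (\<lambda>i. s * p i)))"
    by (intro sum_mono emeasure_subadditive_finite) auto
  also have "\<dots> = (\<Sum>p\<in>S. ennreal (2 * (V * \<rho> ^ m)))"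
    using \<open>\<rho> > 0\<close> \<open>V > 0\<close> by (intro sum.cong refl) (simp add: vol ennreal_mult)
  also have "\<dots> = ennreal (real (card S) * (2 * (V * \<rho> ^ m)))"
    using \<open>\<rho> > 0\<close> \<open>V > 0\<close> by (subst sum_ennreal) simp_all
  also have "\<dots> < ennreal V"
    using small \<open>V > 0\<close> mult_strict_left_mono[OF small \<open>V > 0\<close>]
    by (intro ennreal_lessI) (auto simp: \<rho>_def algebra_simps)
  also have "\<dots> = emeasure ?M (ball 1 (\<lambda>_. 0))"
    using vol[of 1 "\<lambda>_. 0"] by simp
  finally have less: "emeasure ?M C < emeasure ?M (ball 1 (\<lambda>_. 0))" .
  have "C \<in> sets ?M" unfolding C_def using \<open>finite S\<close> by auto
  then have "\<not> ball 1 (\<lambda>_. 0) \<subseteq> C"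
    using less emeasure_mono[of "ball 1 (\<lambda>_. 0)" C ?M] by auto
  then obtain y where y: "y \<in> ball 1 (\<lambda>_. 0)" "y \<notin> C" by blast
  define r where "r = sqrt (\<Sum>i<m. (y i)\<^sup>2)"
  have r2: "(\<Sum>i<m. (y i)\<^sup>2) = r\<^sup>2" by (simp add: r_def sum_nonneg)
  have "r \<ge> 0" by (simp add: r_def sum_nonneg)
  have "r \<le> 1" using y(1) r2 \<open>r \<ge> 0\<close> by (simp add: ball_def abs_square_le_1)
  have cap: "s * (\<Sum>i<m. p i * y i) < r/3" if "p \<in> S" "s \<in> {1,-1}" for p s
  proof -
    have "y \<notin> ball \<rho> (\<lambda>i. (s/3) * p i)" using y(2) that by (auto simp: C_def)
    moreover have "y \<in> space ?M" using y(1) by (simp add: ball_def)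
    ultimately have "8/9 < (\<Sum>i<m. (y i - (s/3) * p i)\<^sup>2)"
      using \<open>\<rho>\<^sup>2 = 8/9\<close> by (simp add: ball_def)
    also have "\<dots> = (\<Sum>i<m. (y i)\<^sup>2 - (2 * s / 3) * (p i * y i) + s\<^sup>2/9 * (p i)\<^sup>2)"
      by (intro sum.cong refl) (simp add: power2_eq_square field_simps)
    also have "\<dots> = r\<^sup>2 - (2 * s / 3) * (\<Sum>i<m. p i * y i) + s\<^sup>2/9"
      unfolding sum.distrib sum_subtractf sum_distrib_left[symmetric] r2 unit[OF that(1)] by simp
    finally have "s * (\<Sum>i<m. p i * y i) < 3/2 * (r\<^sup>2 - 7/9)"
      using that(2) by auto
    \<comment> \<open>This is where the radius of the covering balls matters: equality holds for \<open>r = 1\<close>, that is,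
      on the rim of the cap.\<close>
    also have "\<dots> \<le> r/3"
    proof -
      have "(9 * r + 7) * (r - 1) \<le> 0" using \<open>r \<ge> 0\<close> \<open>r \<le> 1\<close> by (intro mult_nonneg_nonpos) auto
      then show ?thesis by (simp add: power2_eq_square algebra_simps)
    qed
    finally show ?thesis .
  qed
  \<comment> \<open>The origin lies in every covering ball; this needs at least one vector \<^term>\<open>p\<close>.\<close>
  have "r > 0"
  proof -
    obtain p where "p \<in> S" using \<open>S \<noteq> {}\<close> by blast
    then show ?thesis using cap[of p 1] cap[of p "-1"] \<open>r \<ge> 0\<close> by auto
  qed
  define x where "x i = (if i < m then y i / r else 0)" for i
  show ?thesis
  proof
    show "(\<Sum>i<m. (x i)\<^sup>2) = 1"
      using r2 \<open>r > 0\<close> by (simp add: x_def power_divide flip: sum_divide_distrib)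
    show "x i = 0" if "i \<ge> m" for i using that by (simp add: x_def)
    show "\<bar>\<Sum>i<m. p i * x i\<bar> < 1/3" if "p \<in> S" for p
    proof -
      have "(\<Sum>i<m. p i * x i) = (\<Sum>i<m. p i * y i) / r"
        by (simp add: x_def flip: sum_divide_distrib)
      moreover have "\<bar>\<Sum>i<m. p i * y i\<bar> < r/3"
        using cap[OF that, of 1] cap[OF that, of "-1"] by auto
      ultimately show ?thesis using \<open>r > 0\<close> by (simp add: abs_divide divide_less_eq)
    qed
  qed
qed

text \<open>
  Greedy choice: as long as fewer than half of \<open>(3 / sqrt 8) ^ m\<close> vectors have been
  selected, the excluded caps leave room for another one.
\<close>

lemma spherical_code_exists:
  assumes "m > 0" "real n < (3 / sqrt 8) ^ m / 2 + 1"
  shows "\<exists>S. finite S \<and> card S = n \<and> (\<forall>p\<in>S. p \<in> Rn m \<and> dotp m p p = 1) \<and>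
     (\<forall>p\<in>S. \<forall>q\<in>S. p \<noteq> q \<longrightarrow> \<bar>dotp m p q\<bar> < 1/3)"
  using assms(2)
proof (induction n)
  case 0
  show ?case by (rule exI[of _ "{}"]) auto
next
  case (Suc n)
  then obtain S where S: "finite S" "card S = n" "\<forall>p\<in>S. p \<in> Rn m \<and> dotp m p p = 1"
     "\<forall>p\<in>S. \<forall>q\<in>S. p \<noteq> q \<longrightarrow> \<bar>dotp m p q\<bar> < 1/3" by force
  have "\<exists>x\<in>Rn m. dotp m x x = 1 \<and> (\<forall>p\<in>S. \<bar>dotp m p x\<bar> < 1/3)"
  proof (cases "S = {}")
    case True
    have "dotp m (\<lambda>i. if i = 0 then 1 else 0) (\<lambda>i. if i = 0 then 1 else 0) = 1"
      using \<open>m > 0\<close> by (simp add: dotp_def if_distrib[of "\<lambda>x. x * _"] cong: if_cong)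
    then show ?thesis using True \<open>m > 0\<close>
      by (intro bexI[of _ "\<lambda>i. if i = 0 then 1 else 0"]) (auto simp: topspace_Euclidean_space)
  next
    case False
    have "2 * real (card S) < (3 / sqrt 8) ^ m" using Suc.prems S(2) by simp
    then have "2 * real (card S) * (sqrt 8 / 3) ^ m < (3 / sqrt 8) ^ m * (sqrt 8 / 3) ^ m"
      by (intro mult_strict_right_mono) auto
    also have "\<dots> = 1" by (simp flip: power_mult_distrib)
    finally have "2 * real (card S) * (sqrt 8 / 3) ^ m < 1" .
    then obtain x where "(\<Sum>i<m. (x i)\<^sup>2) = 1" "\<And>i. i \<ge> m \<Longrightarrow> x i = 0"
       "\<And>p. p \<in> S \<Longrightarrow> \<bar>\<Sum>i<m. p i * x i\<bar> < 1/3"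
      using sphere_point_outside_caps[OF S(1) False] S(3)
      by (auto simp: dotp_def power2_eq_square)
    then show ?thesis by (intro bexI[of _ x]) (auto simp: topspace_Euclidean_space dotp_def power2_eq_square)
  qed
  then obtain x where x: "x \<in> Rn m" "dotp m x x = 1" "\<And>p. p \<in> S \<Longrightarrow> \<bar>dotp m p x\<bar> < 1/3" by blast
  have "x \<notin> S" using x(2,3) by force
  have "\<bar>dotp m x p\<bar> < 1/3" if "p \<in> S" for p
    using x(3)[OF that] by (simp add: dotp_def mult.commute)
  with S x \<open>x \<notin> S\<close> show ?case by (intro exI[of _ "insert x S"]) auto
qed

section \<open>The exponential lower bound\<close>

text \<open>
  One additional coordinate turns the inner product \<open>c\<close> of two code vectors into the affine
  expression \<open>(3 * c - 1) / 2\<close>. It maps 1 to 1 and the open interval between -1/3 and 1/3 onto the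
  one between -1 and 0, which is what an obtuse system requires and explains the bound 1/3 on the
  inner products.
\<close>

lemma body_with_large_separable_Hadwiger_number:
  assumes "m > 0"
  shows "\<exists>K. convex_body (Suc m) K \<and> smooth_body (Suc m) K \<and> strictly_convex (Suc m) K \<and>
    real (H_sep (Suc m) K) \<ge> (3 / sqrt 8) ^ m / 2"
proof -
  define x :: real where "x = (3 / sqrt 8) ^ m / 2"
  have "x > 0" by (simp add: x_def)
  define n where "n = nat \<lceil>x\<rceil>"
  have n: "x \<le> real n" "real n < x + 1" using \<open>x > 0\<close> unfolding n_def by linarith+
  then obtain S where S: "finite S" "card S = n" "\<And>p. p \<in> S \<Longrightarrow> dotp m p p = 1"
     "\<And>p q. p \<in> S \<Longrightarrow> q \<in> S \<Longrightarrow> p \<noteq> q \<Longrightarrow> \<bar>dotp m p q\<bar> < 1/3"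
    using spherical_code_exists[OF assms, of n] by (auto simp: x_def)
  define ext where "ext p c = (\<lambda>i. if i < m then p i else if i = m then c else 0)"
    for p :: "nat \<Rightarrow> real" and c :: real
  have ext: "ext p c \<in> Rn (Suc m)" for p c by (auto simp: ext_def topspace_Euclidean_space)
  have dot: "dotp (Suc m) (ext p c) (ext q c') = dotp m p q + c * c'" for p q c c'
    by (simp add: dotp_def ext_def)
  have "\<exists>K. convex_body (Suc m) K \<and> smooth_body (Suc m) K \<and> strictly_convex (Suc m) K \<and>
     card S \<le> H_sep (Suc m) K"
  proof (rule body_from_obtuse_system[where \<rho> = 2 and u = "\<lambda>p. ext p 1" and f = "\<lambda>p. ext ((3/2) *\<^sub>R p) (-1/2)"])
    fix p q assume "p \<in> S" "q \<in> S" "p \<noteq> q"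
    then show "-1 < dotp (Suc m) (ext ((3/2) *\<^sub>R p) (-1/2)) (ext q 1) \<and>
        dotp (Suc m) (ext ((3/2) *\<^sub>R p) (-1/2)) (ext q 1) < 0"
      using S(4)[of p q] by (auto simp: dot dotp_linear)
  qed (use S ext in \<open>auto simp: dot dotp_linear\<close>)
  then show ?thesis using n(1) S(2) unfolding x_def by (meson of_nat_mono order_trans)
qed

theorem theorem3:
  shows "\<exists>c::real. c > 0 \<and> (\<exists>d0::nat. \<forall>d\<ge>d0. \<exists>K.
    convex_body d K \<and> smooth_body d K \<and> strictly_convex d K \<and>
    real (H_sep d K) \<ge> c * (3 / sqrt 8) ^ d)"
proof (intro exI[of _ "sqrt 8 / 6"] exI[of _ 2] conjI allI impI)
  show "sqrt 8 / 6 > (0::real)" by simp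
  fix d :: nat assume "d \<ge> 2"
  then obtain m where d: "d = Suc m" "m > 0" by (cases d) auto
  have "sqrt 8 / 6 * (3 / sqrt 8) ^ d = (3 / sqrt 8) ^ m / 2" by (simp add: d)
  then show "\<exists>K. convex_body d K \<and> smooth_body d K \<and> strictly_convex d K \<and>
    real (H_sep d K) \<ge> sqrt 8 / 6 * (3 / sqrt 8) ^ d"
    using body_with_large_separable_Hadwiger_number[OF d(2)] d(1) by simp
qed

end
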